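(* There exists a sparse paving matroid $\mathsf{M}$ with $20$ elements, rank $9$ and having (exactly) $8398$ circuit-hyperplanes, and hence having Ehrhart polynomial $\operatorname{ehr}(\mathsf{M},t)$ with negative quadratic and cubic coefficients (that is, the coefficients of $t^2$ and of $t^3$ are both negative).
   Context: For a matroid $\mathsf{M}$ on $E=\{1,\ldots,n\}$ with set of bases $\mathscr{B}$, the base polytope is $\mathscr{P}(\mathsf{M})=\operatorname{conv}\{e_B : B\in\mathscr{B}\}\subseteq\mathbb{R}^n$, where $e_B=\sum_{i\in B}e_i$. The Ehrhart polynomial $\operatorname{ehr}(\mathsf{M},t)$ is the polynomial with $\operatorname{ehr}(\mathsf{M},t)=\#(t\mathscr{P}(\mathsf{M})\cap\mathbb{Z}^n)$ for all nonnegative integers $t$. A matroid of rank $k$ is paving if every circuit has cardinality at least $k$; it is sparse paving if both it and its dual are paving. A hyperplane is a flat of rank $k-1$; a circuit-hyperplane is a subset that is both a circuit and a hyperplane. *)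

theory Defs
  imports "HOL-Analysis.Analysis" "HOL-Computational_Algebra.Polynomial"
begin

locale matroid =
  fixes E :: "'a set" and \<B> :: "'a set set"
  assumes finite_ground: "finite E"
    and bases_subset: "\<And>B. B \<in> \<B> \<Longrightarrow> B \<subseteq> E"
    and bases_nonempty: "\<B> \<noteq> {}"
    and basis_exchange:
      "\<And>B1 B2 x. B1 \<in> \<B> \<Longrightarrow> B2 \<in> \<B> \<Longrightarrow> x \<in> B1 - B2 \<Longrightarrow>
        \<exists>y \<in> B2 - B1. insert y (B1 - {x}) \<in> \<B>"

definition dual_bases :: "'a set \<Rightarrow> 'a set set \<Rightarrow> 'a set set" where
  "dual_bases E \<B> = (\<lambda>B. E - B) ` \<B>"

definition indep :: "'a set set \<Rightarrow> 'a set \<Rightarrow> bool" where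
  "indep \<B> I \<longleftrightarrow> (\<exists>B\<in>\<B>. I \<subseteq> B)"

definition rank_of :: "'a set set \<Rightarrow> 'a set \<Rightarrow> nat" where
  "rank_of \<B> A = Max (card ` {I. I \<subseteq> A \<and> indep \<B> I})"

definition circuit :: "'a set \<Rightarrow> 'a set set \<Rightarrow> 'a set \<Rightarrow> bool" where
  "circuit E \<B> C \<longleftrightarrow> C \<subseteq> E \<and> \<not> indep \<B> C \<and> (\<forall>D. D \<subset> C \<longrightarrow> indep \<B> D)"

definition flat :: "'a set \<Rightarrow> 'a set set \<Rightarrow> 'a set \<Rightarrow> bool" where
  "flat E \<B> F \<longleftrightarrow> F \<subseteq> E \<and> (\<forall>x \<in> E - F. rank_of \<B> F < rank_of \<B> (insert x F))"

definition matroid_hyperplane :: "'a set \<Rightarrow> 'a set set \<Rightarrow> 'a set \<Rightarrow> bool" where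
  "matroid_hyperplane E \<B> H \<longleftrightarrow> flat E \<B> H \<and> rank_of \<B> H + 1 = rank_of \<B> E"

definition circuit_hyperplanes :: "'a set \<Rightarrow> 'a set set \<Rightarrow> 'a set set" where
  "circuit_hyperplanes E \<B> = {C. circuit E \<B> C \<and> matroid_hyperplane E \<B> C}"

definition paving :: "'a set \<Rightarrow> 'a set set \<Rightarrow> bool" where
  "paving E \<B> \<longleftrightarrow> (\<forall>C. circuit E \<B> C \<longrightarrow> rank_of \<B> E \<le> card C)"

definition sparse_paving :: "'a set \<Rightarrow> 'a set set \<Rightarrow> bool" where
  "sparse_paving E \<B> \<longleftrightarrow> paving E \<B> \<and> paving E (dual_bases E \<B>)"

text \<open>For the polytope the ground set is a whole finite type, which also indexes the
  coordinates; a matroid on an n-element ground set lives on \<open>UNIV\<close> of a type with n elements.\<close>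

definition indicator_vec :: "'n::finite set \<Rightarrow> real ^ 'n" where
  "indicator_vec B = (\<Sum>i\<in>B. axis i 1)"

definition base_polytope :: "'n::finite set set \<Rightarrow> (real ^ 'n) set" where
  "base_polytope \<B> = convex hull (indicator_vec ` \<B>)"

definition lattice_points :: "(real ^ 'n::finite) set" where
  "lattice_points = {x. \<forall>i. x $ i \<in> \<int>}"

text \<open>A polynomial is determined by its values at the natural numbers, so at most one \<open>p\<close>
  satisfies this.\<close>

definition is_ehrhart_polynomial :: "'n::finite set set \<Rightarrow> real poly \<Rightarrow> bool" where
  "is_ehrhart_polynomial \<B> p \<longleftrightarrow>
    (\<forall>t::nat. poly p (real t) =
       real (card ((\<lambda>x. real t *\<^sub>R x) ` base_polytope \<B> \<inter> lattice_points)))"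

end

theory Submission
  imports Defs "HOL-Computational_Algebra.Formal_Power_Series"
begin

text \<open>Let \<open>S\<close> be a family of \<open>k\<close>-subsets of an \<open>n\<close>-set, any two of which differ by more than one
  exchange. Then the \<open>k\<close>-sets outside \<open>S\<close> are the bases of a sparse paving matroid whose
  circuit-hyperplanes are exactly the members of \<open>S\<close>. Its base polytope is the hypersimplex cut by
  the inequalities \<open>x(H) \<le> k - 1\<close> for \<open>H \<in> S\<close>, and the pieces cut off from the dilated hypersimplex
  are pairwise disjoint and have equally many lattice points, namely
  \<open>\<Sum>s<t. ((s + k - 1) choose (k - 1)) * ((s + n - k - 1) choose (n - k - 1))\<close>. Hence the Ehrhart
  polynomial depends only on \<open>k\<close>, \<open>n\<close> and \<open>|S|\<close>, and it decreases linearly with \<open>|S|\<close>. For \<open>n = 20\<close>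
  and \<open>k = 9\<close> the 9-subsets of the integers modulo 20 with a suitable constant sum give a family of
  size at least \<open>(20 choose 9) / 20 = 8398\<close>, which is large enough to make two coefficients
  negative.\<close>

subsection \<open>Sparse paving matroids from codes\<close>

lemma card_Compl_UNIV: "card (- A) = CARD('n) - card (A :: 'n::finite set)"
  by (simp add: Compl_eq_Diff_UNIV card_Diff_subset)

text \<open>Since all members have size \<open>k\<close>, \<open>sep\<close> says that distinct
  indicator vectors have Hamming distance at least 4: \<open>S\<close> is a constant-weight code, or
  a stable set of the Johnson graph.\<close>

locale sparse_code =
  fixes k :: nat and S :: "'n::finite set set"
  assumes k_pos: "0 < k" and k_less: "k < CARD('n)"
    and card_S: "H \<in> S \<Longrightarrow> card H = k"
    and sep: "H \<in> S \<Longrightarrow> H' \<in> S \<Longrightarrow> H \<noteq> H' \<Longrightarrow> 2 \<le> card (H - H')"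
begin

definition bases :: "'n set set" where
  "bases = {B. card B = k} - S"

lemma sep_exchange:
  assumes "H \<in> S" "x \<in> H" "y \<notin> H"
  shows "insert y (H - {x}) \<notin> S"
proof
  assume H': "insert y (H - {x}) \<in> S"
  have "H - insert y (H - {x}) = {x}" using assms by auto
  with sep[OF assms(1) H'] assms show False by auto
qed

lemma card_exchange: "x \<in> B \<Longrightarrow> y \<notin> B \<Longrightarrow> card (insert y (B - {x :: 'n})) = card B"
  using card_Suc_Diff1[of B x] by (simp del: card_Diff_insert)

text \<open>If a \<open>k\<close>-set above \<open>I\<close> lies in \<open>S\<close>, exchanging
  one of its points outside \<open>I\<close> for a new point leaves \<open>S\<close> by
  \<open>sep_exchange\<close> and still covers \<open>I\<close>.\<close>

lemma extend_to_basis: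
  assumes "card I < k"
  shows "\<exists>B\<in>bases. I \<subseteq> B"
proof -
  obtain J where J: "I \<subseteq> J" "card J = k"
    using exists_subset_between[of I k UNIV] assms k_less by auto
  show ?thesis
  proof (cases "J \<in> S")
    case False
    with J show ?thesis by (auto simp: bases_def)
  next
    case True
    obtain x where x: "x \<in> J" "x \<notin> I"
      using J assms by (cases "I = J") auto
    have "J \<noteq> UNIV" using J k_less by auto
    then obtain y where y: "y \<notin> J" by blast
    have "card (insert y (J - {x})) = k"
      using card_exchange[OF x(1) y] J(2) by (rule trans)
    then have "insert y (J - {x}) \<in> bases"
      using sep_exchange[OF True x(1) y] unfolding bases_def by blast
    moreover have "I \<subseteq> insert y (J - {x})" using J(1) x(2) by blast
    ultimately show ?thesis by blast
  qed
qed

lemma indep_iff: "indep bases I \<longleftrightarrow> card I < k \<or> card I = k \<and> I \<notin> S"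
proof
  assume "indep bases I"
  then obtain B where B: "I \<subseteq> B" "card B = k" "B \<notin> S"
    by (auto simp: indep_def bases_def)
  have "card I \<le> k" using card_mono[of B I] B by simp
  moreover have "I = B" if "card I = k"
    using that B card_subset_eq[of B I] by simp
  ultimately show "card I < k \<or> card I = k \<and> I \<notin> S" using B by fastforce
next
  assume "card I < k \<or> card I = k \<and> I \<notin> S"
  then show "indep bases I"
    using extend_to_basis by (auto simp: indep_def bases_def)
qed

lemma bases_nonempty: "bases \<noteq> {}"
  using extend_to_basis[of "{}"] k_pos by auto

text \<open>If every exchange for \<open>x\<close> fails, all candidates lie in \<open>S\<close>.
  Two distinct candidates would differ by one exchange, so \<open>B2 - B1\<close> is a single point;
  the only candidate is then \<open>B2\<close> itself, which is a basis.\<close>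

lemma matroid_bases: "matroid UNIV bases"
proof
  fix B1 B2 x assume B: "B1 \<in> bases" "B2 \<in> bases" and x: "x \<in> B1 - B2"
  then have card: "card B1 = k" "card B2 = k" and notin: "B2 \<notin> S" by (auto simp: bases_def)
  have cardD: "card (B2 - B1) = card (B1 - B2)"
    by (simp add: card card_Diff_subset_Int Int_commute)
  moreover have "card (B1 - B2) \<noteq> 0" using x by auto
  ultimately have "B2 - B1 \<noteq> {}" by force
  then obtain y where y: "y \<in> B2 - B1" by blast
  show "\<exists>y\<in>B2 - B1. insert y (B1 - {x}) \<in> bases"
  proof (rule ccontr)
    assume contra: "\<not> ?thesis"
    have inS: "insert z (B1 - {x}) \<in> S" if "z \<in> B2 - B1" for z
      using contra that card_exchange[of x B1 z] x card by (auto simp: bases_def)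
    have "z = y" if "z \<in> B2 - B1" for z
    proof (rule ccontr)
      assume "z \<noteq> y"
      then have "insert z (B1 - {x}) = insert z (insert y (B1 - {x}) - {y})"
        using y by auto
      moreover have "insert z (insert y (B1 - {x}) - {y}) \<notin> S"
        by (rule sep_exchange[OF inS[OF y]]) (use that \<open>z \<noteq> y\<close> in auto)
      ultimately show False using inS[OF that] by simp
    qed
    then have "B2 - B1 = {y}" using y by blast
    moreover from this have "card (B1 - B2) = 1" using cardD by simp
    then obtain w where "B1 - B2 = {w}" by (rule card_1_singletonE)
    then have "B1 - B2 = {x}" using x by auto
    ultimately have "insert y (B1 - {x}) = B2" by blast
    with inS[OF y] notin show False by simp
  qed
qed (use bases_nonempty in auto)

lemma rank_of_eqI:
  assumes "I \<subseteq> A" "indep bases I" "\<And>J. J \<subseteq> A \<Longrightarrow> indep bases J \<Longrightarrow> card J \<le> card I"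
  shows "rank_of bases A = card I"
  unfolding rank_of_def using assms by (intro Max_eqI) auto

lemma rank_UNIV: "rank_of bases UNIV = k"
proof -
  obtain B where "B \<in> bases" using bases_nonempty by blast
  then have B: "card B = k" "B \<notin> S" by (auto simp: bases_def)
  have "rank_of bases UNIV = card B"
    by (rule rank_of_eqI) (use B in \<open>auto simp: indep_iff\<close>)
  then show ?thesis using B by simp
qed

lemma paving_bases: "paving UNIV bases"
  unfolding paving_def circuit_def rank_UNIV indep_iff by auto

section \<open>The dual matroid\<close>

lemma dual_bases_eq: "dual_bases UNIV bases = {B. card B = CARD('n) - k} - uminus ` S"
proof -
  have "B \<in> uminus ` bases \<longleftrightarrow> card B = CARD('n) - k \<and> B \<notin> uminus ` S" for B :: "'n set"
  proof -
    have im: "B \<in> uminus ` X \<longleftrightarrow> - B \<in> X" for X :: "'n set set"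
      by (auto intro!: image_eqI[where x = "- B"])
    have "card (- B) = CARD('n) - card B" "card B \<le> CARD('n)"
      by (simp_all add: card_Compl_UNIV card_mono)
    then show ?thesis using k_less unfolding im bases_def by auto
  qed
  then show ?thesis by (auto simp: dual_bases_def Compl_eq_Diff_UNIV[symmetric])
qed

text \<open>Complementation reverses set differences, so separation persists. The dual matroid is
  thus of the same kind, and its paving property follows by interpreting the locale again.\<close>

lemma dual_code: "sparse_code (CARD('n) - k) (uminus ` S)"
proof
  show "card H = CARD('n) - k" if "H \<in> uminus ` S" for H
    using that card_S by (auto simp: card_Compl_UNIV)
  show "2 \<le> card (H - H')" if "H \<in> uminus ` S" "H' \<in> uminus ` S" "H \<noteq> H'" for H H'
  proof -
    obtain A B where AB: "A \<in> S" "B \<in> S" "H = - A" "H' = - B" using \<open>H \<in> _\<close> \<open>H' \<in> _\<close> by auto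
    then have "H - H' = B - A" by auto
    with sep[of B A] AB \<open>H \<noteq> H'\<close> show ?thesis by auto
  qed
qed (use k_pos k_less in auto)

lemma sparse_paving_bases: "sparse_paving UNIV bases"
proof -
  interpret dual: sparse_code "CARD('n) - k" "uminus ` S" by (rule dual_code)
  show ?thesis
    using paving_bases dual.paving_bases
    by (simp add: sparse_paving_def dual_bases_eq dual.bases_def)
qed

text \<open>A member of \<open>S\<close> is dependent with independent proper subsets, and adjoining
  any point creates a basis by exchange, so it is a flat of rank \<open>k - 1\<close>. Conversely, a
  circuit outside \<open>S\<close> has more than \<open>k\<close> elements; its
  \<open>k\<close>-subsets are independent, so its rank exceeds \<open>k - 1\<close>.\<close>

lemma circuit_hyperplanes_eq: "circuit_hyperplanes UNIV bases = S"
proof (intro equalityI subsetI)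
  fix H assume H: "H \<in> S"
  have card: "card H = k" by (rule card_S[OF H])
  have circ: "circuit UNIV bases H"
    unfolding circuit_def indep_iff
    using H card psubset_card_mono[of H] by auto
  obtain x where x: "x \<in> H" using card k_pos by fastforce
  have "rank_of bases H = card (H - {x})"
  proof (rule rank_of_eqI)
    show "indep bases (H - {x})" using x card k_pos by (simp add: indep_iff)
    fix J assume J: "J \<subseteq> H" "indep bases J"
    then have "J \<noteq> H" using circ by (auto simp: circuit_def)
    then have "card J < k" using J card psubset_card_mono[of H J] by auto
    then show "card J \<le> card (H - {x})" using x card by simp
  qed auto
  then have rk: "rank_of bases H = k - 1" using x card by simp
  have "rank_of bases (insert y H) = k" if y: "y \<notin> H" for y
  proof -
    let ?B = "insert y (H - {x})"
    have *: "card ?B = k" "?B \<notin> S" "?B \<subseteq> insert y H"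
      using card_exchange[OF x y] card sep_exchange[OF H x y] by auto
    have "rank_of bases (insert y H) = card ?B"
      by (rule rank_of_eqI) (use * in \<open>auto simp only: indep_iff\<close>)
    then show ?thesis using *(1) by (rule trans)
  qed
  then show "H \<in> circuit_hyperplanes UNIV bases"
    using circ rk k_pos
    by (simp add: circuit_hyperplanes_def matroid_hyperplane_def flat_def rank_UNIV)
next
  fix C assume "C \<in> circuit_hyperplanes UNIV bases"
  then have circ: "circuit UNIV bases C" and rk: "rank_of bases C + 1 = k"
    by (auto simp: circuit_hyperplanes_def matroid_hyperplane_def rank_UNIV)
  have le: "card I \<le> rank_of bases C" if "I \<subseteq> C" "indep bases I" for I
    unfolding rank_of_def using that by (intro Max_ge) auto
  have dep: "\<not> indep bases C" using circ by (simp add: circuit_def)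
  show "C \<in> S"
  proof (rule ccontr)
    assume "C \<notin> S"
    with dep have "k < card C" by (auto simp: indep_iff)
    then obtain I where I: "I \<subseteq> C" "card I = k"
      using obtain_subset_with_card_n[of k C] by auto
    with \<open>k < card C\<close> have "indep bases I" using circ by (auto simp: circuit_def)
    with le[OF I(1)] I rk show False by simp
  qed
qed

end

text \<open>Two \<open>k\<close>-sets that differ by a single exchange have different element sums in an abelian
  group, so each fibre of the element sum is a code; the pigeonhole principle provides a large one
  (Graham and Sloane).\<close>

lemma exists_sparse_code:
  assumes "0 < k" "k < CARD('n::{finite,ab_group_add})"
    and m: "m * CARD('n) \<le> CARD('n) choose k"
  shows "\<exists>S :: 'n set set. sparse_code k S \<and> card S = m"
proof -
  let ?K = "{A :: 'n set. card A = k}"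
  have "\<exists>v. m \<le> card {A \<in> ?K. \<Sum>A = v}"
  proof (rule ccontr)
    assume "\<not> ?thesis"
    then have less: "card {A \<in> ?K. \<Sum>A = v} < m" for v by (simp add: not_le)
    have "CARD('n) choose k = card ?K"
      using n_subsets[of "UNIV :: 'n set" k] by simp
    also have "\<dots> = card (\<Union>v. {A \<in> ?K. \<Sum>A = v})" by (rule arg_cong[of _ _ card]) auto
    also have "\<dots> = (\<Sum>v\<in>UNIV. card {A \<in> ?K. \<Sum>A = v})"
      by (rule card_UN_disjoint) auto
    also have "\<dots> < (\<Sum>v\<in>(UNIV :: 'n set). m)"
      by (rule sum_strict_mono) (use less in auto)
    finally show False using m by (simp add: mult.commute)
  qed
  \<comment> \<open>A subfamily of a fibre is still separated, so the size can be cut down to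
    exactly \<open>m\<close>.\<close>
  then obtain v S where S: "S \<subseteq> {A \<in> ?K. \<Sum>A = v}" "card S = m"
    by (meson obtain_subset_with_card_n)
  have "sparse_code k S"
  proof
    show "card H = k" if "H \<in> S" for H using that S by auto
    show "2 \<le> card (H - H')" if HH': "H \<in> S" "H' \<in> S" "H \<noteq> H'" for H H'
    proof (rule ccontr)
      assume "\<not> ?thesis"
      then have small: "card (H - H') \<le> 1" by simp
      have card: "card H = k" "card H' = k" and sums: "\<Sum>H = v" "\<Sum>H' = v"
        using HH' S by auto
      have cardD: "card (H' - H) = card (H - H')"
        by (simp add: card card_Diff_subset_Int Int_commute)
      have "card (H - H') \<noteq> 0"
      proof
        assume "card (H - H') = 0"
        with cardD have "H - H' = {}" "H' - H = {}" by simp_all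
        with \<open>H \<noteq> H'\<close> show False by blast
      qed
      then obtain a b where ab: "H - H' = {a}" "H' - H = {b}"
        using small cardD by (metis One_nat_def card_1_singletonE le_SucE le_zero_eq)
      have "\<Sum>H = \<Sum>(H \<inter> H') + a" "\<Sum>H' = \<Sum>(H \<inter> H') + b"
        using sum.Int_Diff[of H "\<lambda>x. x" H'] sum.Int_Diff[of H' "\<lambda>x. x" H] ab
        by (simp_all add: Int_commute)
      then have "a = b" using sums by simp
      with ab show False by auto
    qed
  qed (use assms in auto)
  with S show ?thesis by blast
qed

subsection \<open>The base polytope\<close>

lemma indicator_vec_nth: "indicator_vec B $ i = of_bool (i \<in> B)"
  by (simp add: indicator_vec_def axis_def)

text \<open>Supplies the second coordinate along which a non-integral point of the polytope can be
  perturbed.\<close>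

lemma sum_integer_fractional:
  fixes x :: "'a \<Rightarrow> real"
  assumes "finite A" "sum x A \<in> \<int>" "i \<in> A" "x i \<notin> \<int>"
  shows "\<exists>j\<in>A. j \<noteq> i \<and> x j \<notin> \<int>"
proof (rule ccontr)
  assume "\<not> ?thesis"
  then have "sum x (A - {i}) \<in> \<int>" by (intro Ints_sum) auto
  moreover have "x i = sum x A - sum x (A - {i})"
    using assms by (simp add: sum_diff1)
  ultimately show False using assms by auto
qed

context sparse_code
begin

definition region :: "(real ^ 'n) set" where
  "region = {x. (\<forall>i. 0 \<le> x $ i \<and> x $ i \<le> 1) \<and> (\<Sum>i\<in>UNIV. x $ i) = real k
     \<and> (\<forall>H\<in>S. (\<Sum>i\<in>H. x $ i) \<le> real k - 1)}"

lemma compact_region: "compact region"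
proof -
  have "region = cbox 0 1 \<inter> ({x. (\<Sum>i\<in>UNIV. x $ i) = real k} \<inter>
      (\<Inter>H\<in>S. {x. (\<Sum>i\<in>H. x $ i) \<le> real k - 1}))"
    by (auto simp: region_def mem_box_cart)
  moreover have "closed ({x :: real ^ 'n. (\<Sum>i\<in>UNIV. x $ i) = real k} \<inter>
      (\<Inter>H\<in>S. {x. (\<Sum>i\<in>H. x $ i) \<le> real k - 1}))"
    by (intro closed_Int closed_INT ballI closed_Collect_eq closed_Collect_le continuous_intros)
  ultimately show ?thesis by (simp only: compact_Int_closed compact_cbox)
qed

lemma convex_region: "convex region"
proof (rule convexI)
  fix x y :: "real ^ 'n" and u v :: real
  assume xy: "x \<in> region" "y \<in> region" and uv: "0 \<le> u" "0 \<le> v" "u + v = 1"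
  have sums: "(\<Sum>i\<in>A. (u *\<^sub>R x + v *\<^sub>R y) $ i) = u * (\<Sum>i\<in>A. x $ i) + v * (\<Sum>i\<in>A. y $ i)" for A
    by (simp add: sum.distrib sum_distrib_left)
  show "u *\<^sub>R x + v *\<^sub>R y \<in> region"
    unfolding region_def mem_Collect_eq sums
  proof (intro conjI allI ballI)
    fix i
    show "0 \<le> (u *\<^sub>R x + v *\<^sub>R y) $ i" using xy uv by (simp add: region_def)
    show "(u *\<^sub>R x + v *\<^sub>R y) $ i \<le> 1"
      using xy uv convex_bound_le[of "x $ i" 1 "y $ i" u v] by (simp add: region_def)
  next
    show "u * (\<Sum>i\<in>UNIV. x $ i) + v * (\<Sum>i\<in>UNIV. y $ i) = real k"
      using xy uv by (simp add: region_def flip: distrib_right)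
  next
    fix H assume "H \<in> S"
    then show "u * (\<Sum>i\<in>H. x $ i) + v * (\<Sum>i\<in>H. y $ i) \<le> real k - 1"
      using xy uv by (intro convex_bound_le) (auto simp: region_def)
  qed
qed

lemma indicator_vec_in_region:
  assumes "B \<in> bases"
  shows "indicator_vec B \<in> region"
proof -
  have B: "card B = k" "B \<notin> S" using assms by (auto simp: bases_def)
  have sums: "(\<Sum>i\<in>A. indicator_vec B $ i) = real (card (A \<inter> B))" for A
    by (simp add: indicator_vec_nth)
  have "real (card (H \<inter> B)) \<le> real k - 1" if H: "H \<in> S" for H
  proof -
    have "H \<inter> B \<noteq> B"
      using B H card_S[OF H] card_subset_eq[of H B] by (metis finite inf.cobounded1)
    then have "card (H \<inter> B) < k" using B psubset_card_mono[of B "H \<inter> B"] by auto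
    then show ?thesis by simp
  qed
  then show ?thesis using B by (auto simp: region_def sums indicator_vec_nth)
qed

text \<open>The sums over \<open>H\<close> and \<open>H'\<close> add up to \<open>2 * k - 2\<close>,
  so the upper bounds \<open>k\<close> on the union and \<open>k - 2\<close> on the intersection are
  both attained. Hence \<open>x\<close> is 0 off the union and 1 on the intersection, which confines
  fractional coordinates to the symmetric difference.\<close>

lemma tight_separate:
  assumes x: "x \<in> region" and H: "H \<in> S" "H' \<in> S" "H \<noteq> H'"
    and tight: "(\<Sum>i\<in>H. x $ i) = real k - 1" "(\<Sum>i\<in>H'. x $ i) = real k - 1"
    and i: "x $ i \<notin> \<int>"
  shows "i \<in> H \<longleftrightarrow> i \<notin> H'"
proof -
  have x01: "0 \<le> x $ a" "x $ a \<le> 1" for a using x by (auto simp: region_def)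
  have i01: "0 < x $ i" "x $ i < 1"
    using x01[of i] i by (auto simp: less_le)
  have "card H = card (H \<inter> H') + card (H - H')"
    by (metis card_Diff_subset_Int card_mono finite finite_Int inf_le1 le_add_diff_inverse)
  then have "card (H \<inter> H') + 2 \<le> k"
    using sep[OF H] card_S[OF H(1)] by simp
  then have card: "real (card (H \<inter> H')) + 2 \<le> real k" by linarith
  have split: "(\<Sum>i\<in>H \<union> H'. x $ i) + (\<Sum>i\<in>H \<inter> H'. x $ i) = 2 * real k - 2"
    using sum.union_inter[of H H' "\<lambda>i. x $ i"] tight by simp
  have sumU: "(\<Sum>i\<in>UNIV. x $ i) = real k" using x by (simp add: region_def)
  have union: "(\<Sum>i\<in>H \<union> H'. x $ i) \<le> real k"
    using sum_mono2[of UNIV "H \<union> H'" "\<lambda>i. x $ i"] x01 sumU by simp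
  have inter: "(\<Sum>i\<in>H \<inter> H'. x $ i) \<le> real (card (H \<inter> H'))"
    using sum_mono[of "H \<inter> H'" "\<lambda>i. x $ i" "\<lambda>_. 1"] x01 by simp
  show ?thesis
  proof (rule ccontr)
    assume "\<not> ?thesis"
    then consider "i \<in> H \<inter> H'" | "i \<notin> H \<union> H'" by blast
    then show False
    proof cases
      case 1
      then have "(\<Sum>i\<in>H \<inter> H'. x $ i) < (\<Sum>i\<in>H \<inter> H'. 1)"
        using i01 x01 by (intro sum_strict_mono_ex1) auto
      with split union card show False by simp
    next
      case 2
      have "(\<Sum>i\<in>H \<union> H'. x $ i) < (\<Sum>i\<in>UNIV. x $ i)"
        by (rule sum_strict_mono2[of _ _ i]) (use 2 i01 x01 in auto)
      with split inter card sumU show False by simp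
    qed
  qed
qed

text \<open>The direction \<open>e\<^sub>i - e\<^sub>j\<close> then stays inside every tight constraint, so a point with a
  fractional coordinate is not extreme.\<close>

lemma fractional_pair:
  assumes x: "x \<in> region" and i: "x $ i \<notin> \<int>"
  shows "\<exists>j. j \<noteq> i \<and> x $ j \<notin> \<int> \<and>
    (\<forall>H\<in>S. (\<Sum>a\<in>H. x $ a) = real k - 1 \<longrightarrow> (i \<in> H \<longleftrightarrow> j \<in> H))"
proof -
  let ?T = "{H \<in> S. (\<Sum>a\<in>H. x $ a) = real k - 1}"
  have sumU: "(\<Sum>i\<in>UNIV. x $ i) = real k" using x by (simp add: region_def)
  have sepT: "a \<in> H \<longleftrightarrow> a \<notin> H'"
    if "H \<in> ?T" "H' \<in> ?T" "H \<noteq> H'" "x $ a \<notin> \<int>" for H H' a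
    using tight_separate[OF x, of H H' a] that by blast
  \<comment> \<open>By \<open>sepT\<close>, a fractional index lies in exactly one of any two
    distinct tight sets. If \<open>H\<close> contains \<open>i\<close>, a partner inside
    \<open>H\<close> avoids all other tight sets. If no tight set contains \<open>i\<close>, then
    \<open>H\<close> is the only one, and a partner exists in its complement, where the coordinates
    sum to 1.\<close>
  consider H where "H \<in> ?T" "i \<in> H" | H where "H \<in> ?T" "i \<notin> H" "\<forall>H'\<in>?T. i \<notin> H'" | "?T = {}"
    by blast
  then show ?thesis
  proof cases
    case (1 H)
    then have "(\<Sum>a\<in>H. x $ a) \<in> \<int>" by simp
    then obtain j where j: "j \<in> H" "j \<noteq> i" "x $ j \<notin> \<int>"
      using sum_integer_fractional[of H "\<lambda>a. x $ a" i] 1 i by auto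
    have "i \<in> H' \<longleftrightarrow> j \<in> H'" if "H' \<in> ?T" for H'
      using sepT[OF 1(1) that _ i] sepT[OF 1(1) that _ j(3)] 1(2) j(1) by (cases "H' = H") auto
    with j show ?thesis by auto
  next
    case (2 H)
    have "(\<Sum>a\<in>-H. x $ a) = 1"
      using sum.union_disjoint[of H "-H" "\<lambda>a. x $ a"] sumU 2(1) by simp
    then obtain j where j: "j \<notin> H" "j \<noteq> i" "x $ j \<notin> \<int>"
      using sum_integer_fractional[of "-H" "\<lambda>a. x $ a" i] 2 i by auto
    have "H' = H" if "H' \<in> ?T" for H'
      using sepT[OF 2(1) that _ i] 2 that by blast
    with j 2(2) show ?thesis by auto
  next
    case 3
    then show ?thesis
      using sum_integer_fractional[of UNIV "\<lambda>a. x $ a" i] sumU i by auto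
  qed
qed

lemma extreme_point_integral:
  assumes ext: "x extreme_point_of region"
  shows "x $ i \<in> \<int>"
proof (rule ccontr)
  assume i: "x $ i \<notin> \<int>"
  have x: "x \<in> region" using ext by (simp add: extreme_point_of_def)
  obtain j where j: "j \<noteq> i" "x $ j \<notin> \<int>"
    and ij: "\<And>H. H \<in> S \<Longrightarrow> (\<Sum>a\<in>H. x $ a) = real k - 1 \<Longrightarrow> i \<in> H \<longleftrightarrow> j \<in> H"
    using fractional_pair[OF x i] by blast
  have x01: "0 \<le> x $ a" "x $ a \<le> 1" for a using x by (auto simp: region_def)
  have frac: "0 < x $ i" "x $ i < 1" "0 < x $ j" "x $ j < 1"
    using x01[of i] x01[of j] i j(2) by (auto simp: less_le)
  let ?slack = "\<lambda>H. real k - 1 - (\<Sum>a\<in>H. x $ a)"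
  \<comment> \<open>A move by \<open>e\<close> changes each coordinate and each sum over a set by at
    most \<open>\<bar>e\<bar>\<close>. So the least positive slack is a safe step in both
    directions; tight sets, removed by \<open>- {0}\<close>, keep their sums by
    \<open>ij\<close>.\<close>
  define E where "E = {x $ i, 1 - x $ i, x $ j, 1 - x $ j} \<union> (?slack ` S - {0})"
  have E: "finite E" "E \<noteq> {}" by (auto simp: E_def)
  have "0 \<le> ?slack H" if "H \<in> S" for H using x that by (simp add: region_def)
  then have "0 < e" if "e \<in> E" for e
    using that frac unfolding E_def by (force simp: less_le)
  then have pos: "0 < Min E" using E by simp
  have le: "Min E \<le> e" if "e \<in> E" for e using E that by simp
  define y where "y e = x + e *\<^sub>R (axis i 1 - axis j 1)" for e :: real
  have y_nth: "y e $ a = x $ a + e * (of_bool (a = i) - of_bool (a = j))" for e a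
    by (auto simp: y_def axis_def)
  have sums: "(\<Sum>a\<in>A. y e $ a) = (\<Sum>a\<in>A. x $ a) + e * (of_bool (i \<in> A) - of_bool (j \<in> A))"
    for e A
    by (simp add: y_nth sum.distrib sum_subtractf of_bool_def flip: sum_distrib_left)
  have y_in: "y e \<in> region" if e: "\<bar>e\<bar> \<le> Min E" for e
    unfolding region_def mem_Collect_eq sums
  proof (intro conjI allI ballI)
    have "\<bar>e\<bar> \<le> x $ i" "\<bar>e\<bar> \<le> 1 - x $ i" "\<bar>e\<bar> \<le> x $ j" "\<bar>e\<bar> \<le> 1 - x $ j"
      by (rule order_trans[OF e le], simp add: E_def)+
    then show "0 \<le> y e $ a" "y e $ a \<le> 1" for a
      using x01[of a] j(1) by (auto simp: y_nth)
    show "(\<Sum>a\<in>UNIV. x $ a) + e * (of_bool (i \<in> UNIV) - of_bool (j \<in> UNIV)) = real k"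
      using x by (simp add: region_def)
    fix H assume H: "H \<in> S"
    show "(\<Sum>a\<in>H. x $ a) + e * (of_bool (i \<in> H) - of_bool (j \<in> H)) \<le> real k - 1"
    proof (cases "?slack H = 0")
      case True
      with ij[OF H] show ?thesis by simp
    next
      case False
      then have "\<bar>e\<bar> \<le> ?slack H" by (intro order_trans[OF e le]) (use H in \<open>auto simp: E_def\<close>)
      moreover have "(\<Sum>a\<in>H. x $ a) \<le> real k - 1" using x H by (simp add: region_def)
      ultimately show ?thesis by (cases "i \<in> H"; cases "j \<in> H") auto
    qed
  qed
  have "x \<in> open_segment (y (- Min E)) (y (Min E))"
  proof -
    have "y (- Min E) $ i \<noteq> y (Min E) $ i" using pos j(1) by (simp add: y_nth)
    then have "y (- Min E) \<noteq> y (Min E)" by metis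
    moreover have "x = midpoint (y (- Min E)) (y (Min E))"
      by (simp add: midpoint_def y_def vec_eq_iff)
    ultimately show ?thesis by simp
  qed
  moreover have "y (- Min E) \<in> region" "y (Min E) \<in> region" using pos by (auto intro!: y_in)
  ultimately show False using ext by (simp add: extreme_point_of_def)
qed

lemma extreme_point_is_basis:
  assumes ext: "x extreme_point_of region"
  shows "x \<in> indicator_vec ` bases"
proof -
  have x: "x \<in> region" using ext by (simp add: extreme_point_of_def)
  define B where "B = {i. x $ i = 1}"
  have "x $ i = of_bool (i \<in> B)" for i
  proof -
    obtain z where z: "x $ i = of_int z"
      using extreme_point_integral[OF ext, of i] by (auto elim: Ints_cases)
    have "0 \<le> x $ i" "x $ i \<le> 1" using x by (auto simp: region_def)
    then have "z = 0 \<or> z = 1" using z by auto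
    then show ?thesis using z by (auto simp: B_def)
  qed
  then have xB: "x = indicator_vec B" by (simp add: vec_eq_iff indicator_vec_nth)
  then have "(\<Sum>i\<in>A. x $ i) = real (card (A \<inter> B))" for A
    by (simp add: indicator_vec_nth)
  with x have "card B = k" "\<forall>H\<in>S. real (card (H \<inter> B)) \<le> real k - 1" by (auto simp: region_def)
  \<comment> \<open>If \<open>B\<close> were in \<open>S\<close>, the constraint for
    \<open>H = B\<close> would read \<open>k \<le> k - 1\<close>.\<close>
  then have "B \<in> bases" by (auto simp: bases_def)
  with xB show ?thesis by blast
qed

text \<open>A compact convex set is the hull of its extreme points, and those of
  \<open>region\<close> are indicator vectors of bases.\<close>

lemma base_polytope_eq: "base_polytope bases = region"
proof
  show "base_polytope bases \<subseteq> region"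
    unfolding base_polytope_def
    by (intro hull_minimal image_subsetI indicator_vec_in_region convex_region)
  have "region = convex hull {x. x extreme_point_of region}"
    by (rule Krein_Milman_Minkowski[OF compact_region convex_region])
  also have "\<dots> \<subseteq> base_polytope bases"
    unfolding base_polytope_def by (intro hull_mono) (auto intro: extreme_point_is_basis)
  finally show "region \<subseteq> base_polytope bases" .
qed

end

subsection \<open>Lattice points of the dilated polytope\<close>

definition compositions :: "nat \<Rightarrow> 'a set \<Rightarrow> nat \<Rightarrow> ('a \<Rightarrow> nat) set" where
  "compositions t A m = {f \<in> A \<rightarrow>\<^sub>E {..t}. sum f A = m}"

lemma finite_compositions: "finite A \<Longrightarrow> finite (compositions t A m)"
  by (simp add: compositions_def finite_PiE)

text \<open>Expanding the product over \<open>A\<close> chooses one exponent \<open>f a\<close> per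
  index, so each function contributes the monomial of degree \<open>sum f A\<close>.\<close>

lemma fps_nth_compositions:
  assumes "finite A"
  shows "fps_nth ((\<Sum>v\<le>t. fps_X ^ v) ^ card A) m = real (card (compositions t A m))"
proof -
  have "(\<Sum>v\<le>t. fps_X ^ v) ^ card A = (\<Prod>a\<in>A. \<Sum>v\<le>t. fps_X ^ v :: real fps)" by simp
  also have "\<dots> = (\<Sum>f\<in>A \<rightarrow>\<^sub>E {..t}. \<Prod>a\<in>A. fps_X ^ f a)"
    by (rule prod_sum_PiE) (use assms in auto)
  also have "\<dots> = (\<Sum>f\<in>A \<rightarrow>\<^sub>E {..t}. fps_X ^ sum f A)" by (simp add: power_sum)
  finally have "fps_nth ((\<Sum>v\<le>t. fps_X ^ v) ^ card A) m
      = (\<Sum>f\<in>A \<rightarrow>\<^sub>E {..t}. of_bool (sum f A = m) :: real)"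
    by (simp add: fps_sum_nth eq_commute of_bool_def)
  also have "\<dots> = real (card (compositions t A m))"
    using assms by (simp add: compositions_def finite_PiE Int_def)
  finally show ?thesis .
qed

text \<open>The generating function is \<open>(1 - X^(t+1))^n / (1 - X)^n\<close>. The binomial
  theorem for the numerator gives inclusion-exclusion over parts exceeding \<open>t\<close>; the
  case distinction reflects the shift by \<open>X^(j*(t+1))\<close>.\<close>

lemma card_compositions:
  assumes "finite A" "A \<noteq> {}"
  shows "real (card (compositions t A m)) = (\<Sum>j\<le>card A. (-1) ^ j * real (card A choose j) *
    (if m < j * (t + 1) then 0 else real ((m - j * (t + 1) + (card A - 1)) choose (card A - 1))))"
proof -
  define n where "n = card A"
  have n: "0 < n" using assms by (simp add: n_def card_gt_0_iff)
  define U where "U = Abs_fps (\<lambda>k. real ((n + k - 1) choose k))"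
  have inv: "inverse ((1 - fps_X) ^ n) = U"
    using one_minus_const_fps_X_neg_power'[OF n, of "1 :: real"] by (simp add: U_def)
  have geo: "(1 - fps_X) * (\<Sum>v\<le>t. fps_X ^ v) = (1 - fps_X ^ (t + 1) :: real fps)"
    using one_diff_power_eq[of "fps_X :: real fps" "Suc t"] by (simp add: lessThan_Suc_atMost)
  have unit: "(1 - fps_X :: real fps) ^ n * U = 1"
    unfolding inv[symmetric] by (rule inverse_mult_eq_1') simp
  have "(\<Sum>v\<le>t. fps_X ^ v) ^ n = (\<Sum>v\<le>t. fps_X ^ v) ^ n * ((1 - fps_X) ^ n * U)"
    by (simp only: unit mult_1_right)
  also have "\<dots> = ((1 - fps_X) * (\<Sum>v\<le>t. fps_X ^ v)) ^ n * U"
    by (simp only: power_mult_distrib mult_ac)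
  also have "\<dots> = (- (fps_X ^ (t + 1)) + 1) ^ n * U" unfolding geo by simp
  also have "\<dots> = (\<Sum>j\<le>n. fps_const ((-1) ^ j * real (n choose j)) * (fps_X ^ (j * (t + 1)) * U))"
    unfolding binomial_ring sum_distrib_right
  proof (rule sum.cong[OF refl])
    fix j
    have "(- (fps_X ^ (t + 1)) :: real fps) ^ j = (-1) ^ j * fps_X ^ (j * (t + 1))"
      by (simp only: power_minus[of "fps_X ^ (t + 1)"] power_mult[symmetric] mult.commute[of j])
    moreover have "fps_const ((-1) ^ j * real (n choose j)) = (-1) ^ j * of_nat (n choose j)"
      by (metis fps_const_1_eq_1 fps_const_mult fps_const_neg fps_const_power fps_of_nat)
    ultimately show "of_nat (n choose j) * (- (fps_X ^ (t + 1))) ^ j * 1 ^ (n - j) * U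
        = fps_const ((-1) ^ j * real (n choose j)) * (fps_X ^ (j * (t + 1)) * U)"
      by (simp only: power_one mult_1_left mult_ac)
  qed
  finally have eq: "(\<Sum>v\<le>t. fps_X ^ v) ^ n
      = (\<Sum>j\<le>n. fps_const ((-1) ^ j * real (n choose j)) * (fps_X ^ (j * (t + 1)) * U))" .
  have U_nth: "fps_nth U k = real ((k + (n - 1)) choose (n - 1))" for k
    using n binomial_symmetric[of k "n + k - 1"] by (simp add: U_def add.commute)
  show ?thesis
    unfolding fps_nth_compositions[OF assms(1), symmetric] n_def[symmetric] eq
    by (simp only: fps_sum_nth fps_mult_left_const_nth fps_X_power_mult_nth U_nth)
qed

text \<open>For \<open>m \<le> t\<close> only the term \<open>j = 0\<close> survives, leaving the
  stars-and-bars count.\<close>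

lemma card_compositions_small:
  assumes "finite A" "A \<noteq> {}" "m \<le> t"
  shows "card (compositions t A m) = (m + (card A - 1)) choose (card A - 1)"
proof -
  have "real (card (compositions t A m))
      = (\<Sum>j\<le>card A. if j = 0 then real ((m + (card A - 1)) choose (card A - 1)) else 0)"
    unfolding card_compositions[OF assms(1,2)]
  proof (intro sum.cong refl)
    fix j
    have "m < j * (t + 1)" if "j \<noteq> 0"
      using that \<open>m \<le> t\<close> by (cases j) auto
    then show "(-1) ^ j * real (card A choose j) *
        (if m < j * (t + 1) then 0 else real ((m - j * (t + 1) + (card A - 1)) choose (card A - 1)))
      = (if j = 0 then real ((m + (card A - 1)) choose (card A - 1)) else 0)"
      by (cases "j = 0") auto
  qed
  then show ?thesis by simp
qed

section \<open>Lattice points of the dilate and of the pieces cut off\<close>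

context sparse_code
begin

definition dilate_points :: "nat \<Rightarrow> ('n \<Rightarrow> nat) set" where
  "dilate_points t = {f \<in> compositions t UNIV (k * t). \<forall>H\<in>S. sum f H \<le> (k - 1) * t}"

definition cut_points :: "nat \<Rightarrow> 'n set \<Rightarrow> ('n \<Rightarrow> nat) set" where
  "cut_points t H = {f \<in> compositions t UNIV (k * t). (k - 1) * t < sum f H}"

lemma region_nonempty: "region \<noteq> {}"
  using bases_nonempty indicator_vec_in_region by blast

lemma dilate_image:
  "(\<lambda>f. \<chi> i. real (f i)) ` dilate_points t = (\<lambda>x. real t *\<^sub>R x) ` region \<inter> lattice_points"
  (is "?v ` _ = _")
proof (intro equalityI subsetI)
  fix y assume "y \<in> ?v ` dilate_points t"
  then obtain f where y: "y = ?v f" and f: "f \<in> dilate_points t" by blast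
  have le: "f i \<le> t" for i using f by (auto simp: dilate_points_def compositions_def)
  have sumU: "sum f UNIV = k * t" and sumH: "\<And>H. H \<in> S \<Longrightarrow> sum f H \<le> (k - 1) * t"
    using f by (auto simp: dilate_points_def compositions_def)
  have "y \<in> (\<lambda>x. real t *\<^sub>R x) ` region"
  proof (cases "t = 0")
    \<comment> \<open>Rescaling by \<open>1 / t\<close> is impossible here; the dilate is the origin
      because \<open>region\<close> is nonempty.\<close>
    case True
    then have "y = 0" using le by (simp add: y vec_eq_iff)
    then show ?thesis using True region_nonempty by (simp add: image_constant_conv)
  next
    case False
    have sums: "(\<Sum>i\<in>A. ((1 / real t) *\<^sub>R y) $ i) = real (sum f A) / real t" for A
      by (simp add: y sum_divide_distrib)
    have "(1 / real t) *\<^sub>R y \<in> region"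
      unfolding region_def mem_Collect_eq sums
    proof (intro conjI allI ballI)
      show "0 \<le> ((1 / real t) *\<^sub>R y) $ i" "((1 / real t) *\<^sub>R y) $ i \<le> 1" for i
        using le[of i] False by (simp_all add: y)
      show "real (sum f UNIV) / real t = real k" using False by (simp add: sumU)
      fix H assume "H \<in> S"
      from sumH[OF this] have "real (sum f H) \<le> real (k - 1) * real t"
        by (metis of_nat_le_iff of_nat_mult)
      then show "real (sum f H) / real t \<le> real k - 1"
        using False k_pos by (simp add: divide_le_eq of_nat_diff)
    qed
    moreover have "y = real t *\<^sub>R ((1 / real t) *\<^sub>R y)" using False by simp
    ultimately show ?thesis by (rule rev_image_eqI)
  qed
  moreover have "y \<in> lattice_points" by (simp add: y lattice_points_def)
  ultimately show "y \<in> (\<lambda>x. real t *\<^sub>R x) ` region \<inter> lattice_points" by blast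
next
  fix y assume "y \<in> (\<lambda>x. real t *\<^sub>R x) ` region \<inter> lattice_points"
  then obtain x where y: "y = real t *\<^sub>R x" and x: "x \<in> region" and lat: "y \<in> lattice_points" by blast
  define f where "f i = nat \<lfloor>y $ i\<rfloor>" for i
  have x01: "0 \<le> x $ i" "x $ i \<le> 1" for i using x by (auto simp: region_def)
  have f: "real (f i) = real t * x $ i" for i
  proof -
    obtain z where z: "y $ i = of_int z" using lat by (auto simp: lattice_points_def elim: Ints_cases)
    moreover have "0 \<le> y $ i" using x01[of i] by (simp add: y)
    ultimately have "real (f i) = y $ i" by (simp add: f_def)
    then show ?thesis by (simp add: y)
  qed
  have sums: "real (sum f A) = real t * (\<Sum>i\<in>A. x $ i)" for A
    by (simp add: f sum_distrib_left)
  have "f i \<le> t" for i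
    using f[of i] x01[of i] mult_left_le[of "x $ i" "real t"] by simp
  moreover have "sum f UNIV = k * t"
  proof -
    have "real (sum f UNIV) = real (k * t)"
      unfolding sums using x by (simp add: region_def)
    then show ?thesis by (simp only: of_nat_eq_iff)
  qed
  moreover have "sum f H \<le> (k - 1) * t" if "H \<in> S" for H
  proof -
    have "real (sum f H) \<le> real t * (real k - 1)"
      unfolding sums using x that by (intro mult_left_mono) (auto simp: region_def)
    also have "\<dots> = real ((k - 1) * t)" using k_pos by (simp add: of_nat_diff)
    finally show ?thesis by (simp only: of_nat_le_iff)
  qed
  ultimately have "f \<in> dilate_points t"
    by (simp add: dilate_points_def compositions_def PiE_UNIV_domain)
  moreover have "y = ?v f" by (simp add: f y vec_eq_iff)
  ultimately show "y \<in> ?v ` dilate_points t" by blast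
qed

lemma card_dilate:
  "card ((\<lambda>x. real t *\<^sub>R x) ` base_polytope bases \<inter> lattice_points) = card (dilate_points t)"
proof -
  have "inj_on (\<lambda>f. \<chi> i. real (f i)) (dilate_points t)"
    by (auto intro!: inj_onI ext simp: vec_eq_iff)
  then show ?thesis by (simp add: base_polytope_eq card_image flip: dilate_image)
qed

text \<open>The union and intersection sums are at most \<open>k * t\<close> and
  \<open>(k - 2) * t\<close>, so the sums over \<open>H\<close> and \<open>H'\<close> cannot both
  exceed \<open>(k - 1) * t\<close>.\<close>

lemma cut_points_disjoint:
  assumes H: "H \<in> S" "H' \<in> S" "H \<noteq> H'"
  shows "cut_points t H \<inter> cut_points t H' = {}"
proof (rule ccontr)
  assume "\<not> ?thesis"
  then obtain f where f: "f \<in> compositions t UNIV (k * t)" "(k - 1) * t < sum f H" "(k - 1) * t < sum f H'"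
    by (auto simp: cut_points_def)
  have le: "f i \<le> t" for i using f(1) by (auto simp: compositions_def)
  have sumU: "sum f UNIV = k * t" using f(1) by (simp add: compositions_def)
  have "card H = card (H \<inter> H') + card (H - H')"
    by (metis card_Diff_subset_Int card_mono finite finite_Int inf_le1 le_add_diff_inverse)
  then have card: "card (H \<inter> H') + 2 \<le> k"
    using sep[OF H] card_S[OF H(1)] by simp
  have "sum f H + sum f H' = sum f (H \<union> H') + sum f (H \<inter> H')"
    by (simp add: sum.union_inter)
  also have "\<dots> \<le> k * t + card (H \<inter> H') * t"
  proof (rule add_mono)
    show "sum f (H \<union> H') \<le> k * t" unfolding sumU[symmetric] by (rule sum_mono2) auto
    show "sum f (H \<inter> H') \<le> card (H \<inter> H') * t"
      using sum_bounded_above[of "H \<inter> H'" f t] le by simp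
  qed
  also have "\<dots> \<le> k * t + (k - 2) * t" using card by (intro add_left_mono mult_right_mono) auto
  also have "\<dots> = (k - 1) * t + (k - 1) * t"
  proof -
    have "k + (k - 2) = (k - 1) + (k - 1)" using card by simp
    then show ?thesis by (metis add_mult_distrib)
  qed
  finally show False using f by simp
qed

lemma card_compositions_split:
  "card (compositions t (UNIV :: 'n set) (k * t)) = card (dilate_points t) + (\<Sum>H\<in>S. card (cut_points t H))"
proof -
  have fin: "finite (compositions t (UNIV :: 'n set) (k * t))" by (rule finite_compositions) simp
  have "compositions t UNIV (k * t) = dilate_points t \<union> (\<Union>H\<in>S. cut_points t H)"
    by (auto simp: dilate_points_def cut_points_def not_less)
  moreover have "dilate_points t \<inter> (\<Union>H\<in>S. cut_points t H) = {}"
    by (auto simp: dilate_points_def cut_points_def not_less)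
  moreover have "card (\<Union>H\<in>S. cut_points t H) = (\<Sum>H\<in>S. card (cut_points t H))"
    using cut_points_disjoint fin by (intro card_UN_disjoint) (auto simp: cut_points_def)
  ultimately show ?thesis using fin by (simp add: card_Un_disjoint)
qed

text \<open>Reflecting the coordinates in \<open>H\<close> by \<open>x \<mapsto> t - x\<close> turns the part cut off by \<open>H\<close> into pairs
  of compositions of a common \<open>s < t\<close>; the upper bound \<open>t\<close> on the parts is then automatic.\<close>

lemma card_cut_points:
  assumes H: "H \<in> S"
  shows "card (cut_points t H) = (\<Sum>s<t. ((s + (k - 1)) choose (k - 1)) *
    ((s + (CARD('n) - k - 1)) choose (CARD('n) - k - 1)))"
proof -
  have cardH: "card H = k" by (rule card_S[OF H])
  have cardC: "card (- H) = CARD('n) - k" by (simp add: card_Compl_UNIV cardH)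
  \<comment> \<open>The first component is the common sum \<open>s\<close>: reflection turns the
    excess of \<open>sum f H\<close> over \<open>(k - 1) * t\<close> into the bound
    \<open>s < t\<close>. The restrictions make both functions extensional.\<close>
  define to :: "('n \<Rightarrow> nat) \<Rightarrow> nat \<times> ('n \<Rightarrow> nat) \<times> ('n \<Rightarrow> nat)" where
    "to f = (sum f (- H), restrict (\<lambda>i. t - f i) H, restrict f (- H))" for f
  define fro :: "nat \<times> ('n \<Rightarrow> nat) \<times> ('n \<Rightarrow> nat) \<Rightarrow> 'n \<Rightarrow> nat" where
    "fro p i = (if i \<in> H then t - fst (snd p) i else snd (snd p) i)" for p i
  let ?Q = "SIGMA s:{..<t}. compositions t H s \<times> compositions t (- H) s"
  have reflect: "sum (\<lambda>i. t - g i) H + sum g H = k * t" if "\<And>i. i \<in> H \<Longrightarrow> g i \<le> t" for g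
    using that by (simp add: cardH flip: sum.distrib)
  have split: "sum f UNIV = sum f H + sum f (- H)" for f :: "'n \<Rightarrow> nat"
    using sum.union_disjoint[of H "- H" f] by simp
  have kt: "k * t = (k - 1) * t + t" using k_pos by (cases k) auto
  have "bij_betw to (cut_points t H) ?Q"
  proof (rule bij_betw_byWitness[where f' = fro])
    show "\<forall>f\<in>cut_points t H. fro (to f) = f"
      by (auto simp: to_def fro_def cut_points_def compositions_def fun_eq_iff
          PiE_UNIV_domain Pi_iff)
    show "\<forall>p\<in>?Q. to (fro p) = p"
    proof
      fix p assume "p \<in> ?Q"
      then obtain s g h where p: "p = (s, g, h)" and g: "g \<in> compositions t H s"
        and h: "h \<in> compositions t (- H) s" by auto
      have "restrict (\<lambda>i. t - fro p i) H = g"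
        using g by (auto simp: p fro_def compositions_def fun_eq_iff PiE_iff extensional_def)
      moreover have "restrict (fro p) (- H) = h"
        using h by (auto simp: p fro_def compositions_def fun_eq_iff PiE_iff extensional_def)
      moreover have "sum (fro p) (- H) = s"
        using h by (simp add: p fro_def compositions_def)
      ultimately show "to (fro p) = p" by (simp add: to_def p)
    qed
    show "to ` cut_points t H \<subseteq> ?Q"
    proof (rule image_subsetI)
      fix f assume f: "f \<in> cut_points t H"
      then have le: "f i \<le> t" for i by (auto simp: cut_points_def compositions_def)
      have eq: "sum f H + sum f (- H) = k * t" and gt: "(k - 1) * t < sum f H"
        using f by (auto simp: cut_points_def compositions_def split)
      have "sum (\<lambda>i. t - f i) H = sum f (- H)" using reflect[of f] le eq by simp
      moreover have "sum f (- H) < t" using eq gt kt by linarith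
      ultimately show "to f \<in> ?Q" using le by (auto simp: to_def compositions_def)
    qed
    show "fro ` ?Q \<subseteq> cut_points t H"
    proof (rule image_subsetI)
      fix p assume "p \<in> ?Q"
      then obtain s g h where p: "p = (s, g, h)" and s: "s < t" and g: "g \<in> compositions t H s"
        and h: "h \<in> compositions t (- H) s" by auto
      have gle: "g i \<le> t" if "i \<in> H" for i using g that by (auto simp: compositions_def)
      have hle: "h i \<le> t" if "i \<notin> H" for i using h that by (auto simp: compositions_def)
      have "sum (fro p) H = sum (\<lambda>i. t - g i) H" "sum (fro p) (- H) = sum h (- H)"
        by (simp_all add: p fro_def)
      moreover have "sum g H = s" "sum h (- H) = s" using g h by (simp_all add: compositions_def)
      ultimately have "sum (fro p) H + s = k * t" "sum (fro p) (- H) = s"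
        using reflect[of g] gle by auto
      moreover from this have "(k - 1) * t < sum (fro p) H" using kt s by linarith
      moreover have "fro p i \<le> t" for i using hle by (simp add: p fro_def)
      ultimately show "fro p \<in> cut_points t H"
        by (simp add: cut_points_def compositions_def split PiE_UNIV_domain)
    qed
  qed
  then have "card (cut_points t H) = card ?Q" by (rule bij_betw_same_card)
  also have "\<dots> = (\<Sum>s<t. card (compositions t H s) * card (compositions t (- H) s))"
    by (subst card_SigmaI) (auto simp: finite_compositions card_cartesian_product)
  also have "\<dots> = (\<Sum>s<t. ((s + (k - 1)) choose (k - 1)) *
      ((s + (CARD('n) - k - 1)) choose (CARD('n) - k - 1)))"
  proof (rule sum.cong[OF refl])
    fix s assume "s \<in> {..<t}"
    then have s: "s \<le> t" by simp
    have "H \<noteq> {}" "- H \<noteq> {}" using cardH cardC k_pos k_less by auto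
    then show "card (compositions t H s) * card (compositions t (- H) s)
        = ((s + (k - 1)) choose (k - 1)) * ((s + (CARD('n) - k - 1)) choose (CARD('n) - k - 1))"
      using card_compositions_small[of H s t] card_compositions_small[of "- H" s t] s
      by (simp add: cardH cardC)
  qed
  finally show ?thesis .
qed

end

subsection \<open>The Ehrhart polynomial\<close>

definition poch_poly :: "real \<Rightarrow> real \<Rightarrow> nat \<Rightarrow> real poly" where
  "poch_poly a b m = (\<Prod>i<m. [:a + real i, b:])"

lemma poly_poch_poly: "poly (poch_poly a b m) x = pochhammer (a + b * x) m"
  by (simp add: poch_poly_def poly_prod pochhammer_prod lessThan_atLeast0 algebra_simps)

lemma binomial_pochhammer: "real ((s + a) choose a) = pochhammer (real s + 1) a / fact a"
  by (simp add: binomial_gbinomial gbinomial_pochhammer')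

text \<open>With \<open>J = a\<close> this is the difference equation that makes \<open>cut_poly a b\<close> below a closed form
  of \<open>\<Sum>s<t. ((s + a) choose a) * ((s + b) choose b)\<close>.\<close>

lemma sum_pochhammer_shift:
  fixes x :: real
  shows "(x + real b + 1) * (\<Sum>j\<le>J. real ((b + j) choose j) * (pochhammer (x + 1) j / fact j))
    - x * (\<Sum>j\<le>J. real ((b + j) choose j) * (pochhammer x j / fact j))
    = (real b + 1) * real ((b + 1 + J) choose J) * (pochhammer (x + 1) J / fact J)"
proof (induction J)
  case 0
  then show ?case by simp
next
  case (Suc J)
  have A: "pochhammer (x + 1) (Suc J) / fact (Suc J)
      = (x + 1 + real J) / (real J + 1) * (pochhammer (x + 1) J / fact J)"
    by (simp add: pochhammer_rec' field_simps)
  have B: "pochhammer x (Suc J) / fact (Suc J) = x / (real J + 1) * (pochhammer (x + 1) J / fact J)"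
    by (simp add: pochhammer_rec field_simps)
  have C: "real ((b + Suc J) choose Suc J) * (real J + 1) = (real b + 1) * real ((b + 1 + J) choose J)"
  proof -
    have "Suc J * ((b + Suc J) choose Suc J) = Suc b * ((b + Suc J) choose J)"
      using Suc_times_binomial[of J "b + J"] binomial_absorb_comp[of "b + Suc J" J]
      by (simp del: binomial_Suc_Suc mult_Suc)
    then have "real (Suc J * ((b + Suc J) choose Suc J)) = real (Suc b * ((b + Suc J) choose J))"
      by presburger
    then show ?thesis by (simp add: algebra_simps)
  qed
  have D: "(b + 1 + Suc J) choose Suc J = ((b + 1 + J) choose J) + ((b + Suc J) choose Suc J)"
    by simp
  define P where "P = pochhammer (x + 1) J / fact J"
  define c where "c = real ((b + Suc J) choose Suc J)"
  define d where "d = real ((b + 1 + J) choose J)"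
  \<comment> \<open>Eliminating \<open>d\<close> turns the induction step into an identity of
    rational functions.\<close>
  have d: "d = c * (real J + 1) / (real b + 1)"
    using C by (simp add: c_def d_def field_simps)
  have "(real b + 1) * d * P
      + ((x + real b + 1) * (c * ((x + 1 + real J) / (real J + 1) * P)) - x * (c * (x / (real J + 1) * P)))
      = (real b + 1) * (d + c) * ((x + 1 + real J) / (real J + 1) * P)"
    unfolding d by (simp add: divide_simps, simp add: algebra_simps)
  then show ?case
    unfolding sum.atMost_Suc A B D of_nat_add P_def[symmetric] c_def[symmetric] d_def[symmetric]
    using Suc.IH[folded P_def d_def] by (simp add: algebra_simps)
qed

definition cut_poly :: "nat \<Rightarrow> nat \<Rightarrow> real poly" where
  "cut_poly a b = smult (1 / (fact (b + 1) * real ((a + b + 1) choose a))) (poch_poly 0 1 (b + 1) *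
     (\<Sum>j\<le>a. smult (real ((b + j) choose j) / fact j) (poch_poly 0 1 j)))"

text \<open>The factor \<open>poch_poly 0 1 (b + 1)\<close> vanishes at 0, and
  \<open>sum_pochhammer_shift\<close> evaluates the increment from \<open>t\<close> to
  \<open>t + 1\<close>, so the sum telescopes.\<close>

lemma poly_cut_poly:
  "poly (cut_poly a b) (real t)
    = (\<Sum>s<t. real ((s + a) choose a) * real ((s + b) choose b))"
proof (induction t)
  case 0
  then show ?case by (simp add: cut_poly_def poly_poch_poly pochhammer_0_left)
next
  case (Suc t)
  define x where "x = real t"
  define \<Sigma> where "\<Sigma> y = (\<Sum>j\<le>a. real ((b + j) choose j) * (pochhammer y j / fact j))" for y :: real
  define N where "N = fact (b + 1) * real ((a + b + 1) choose a)"
  have N: "N \<noteq> 0" by (simp add: N_def)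
  have val: "poly (cut_poly a b) y = pochhammer y (b + 1) * \<Sigma> y / N" for y
    by (simp add: cut_poly_def poly_poch_poly poly_sum \<Sigma>_def N_def)
  have "poly (cut_poly a b) (x + 1) - poly (cut_poly a b) x
      = (pochhammer (x + 1) (b + 1) * \<Sigma> (x + 1) - pochhammer x (b + 1) * \<Sigma> x) / N"
    by (simp add: val diff_divide_distrib)
  \<comment> \<open>Both rising factorials share the factor
    \<open>(x + 1) ... (x + b)\<close>.\<close>
  also have "pochhammer (x + 1) (b + 1) * \<Sigma> (x + 1) - pochhammer x (b + 1) * \<Sigma> x
      = pochhammer (x + 1) b * ((x + real b + 1) * \<Sigma> (x + 1) - x * \<Sigma> x)"
    using pochhammer_rec'[of "x + 1" b] pochhammer_rec[of x b] by (simp add: algebra_simps)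
  also have "(x + real b + 1) * \<Sigma> (x + 1) - x * \<Sigma> x
      = (real b + 1) * real ((b + 1 + a) choose a) * (pochhammer (x + 1) a / fact a)"
    unfolding \<Sigma>_def by (rule sum_pochhammer_shift)
  also have "pochhammer (x + 1) b * ((real b + 1) * real ((b + 1 + a) choose a) * (pochhammer (x + 1) a / fact a)) / N
      = (pochhammer (x + 1) a / fact a) * (pochhammer (x + 1) b / fact b)"
  proof -
    define c where "c = real ((b + 1 + a) choose a)"
    have "c \<noteq> 0" by (simp add: c_def)
    moreover have "N = (real b + 1) * fact b * c"
      by (simp only: N_def c_def Suc_eq_plus1[symmetric] fact_Suc) (simp add: ac_simps)
    ultimately show ?thesis
      unfolding c_def[symmetric] by (simp add: add_eq_0_iff)
  qed
  also have "\<dots> = real ((t + a) choose a) * real ((t + b) choose b)"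
    unfolding binomial_pochhammer x_def ..
  finally show ?case using Suc.IH by (simp add: x_def add.commute)
qed

text \<open>Katzman's formula for the Ehrhart polynomial of the hypersimplex, with binomials written
  as rising factorials.\<close>

definition hypersimplex_poly :: "nat \<Rightarrow> nat \<Rightarrow> real poly" where
  "hypersimplex_poly k n = (\<Sum>j<k. smult ((-1) ^ j * real (n choose j) / fact (n - 1))
     (poch_poly (1 - real j) (real k - real j) (n - 1)))"

lemma poly_hypersimplex_poly:
  assumes "0 < k" "k < CARD('n::finite)"
  shows "poly (hypersimplex_poly k CARD('n)) (real t) = real (card (compositions t (UNIV :: 'n set) (k * t)))"
proof -
  define n where "n = CARD('n)"
  let ?c = "\<lambda>j. (-1) ^ j * real (n choose j) *
    (if k * t < j * (t + 1) then 0 else real ((k * t - j * (t + 1) + (n - 1)) choose (n - 1)))"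
  have "real (card (compositions t (UNIV :: 'n set) (k * t))) = (\<Sum>j\<le>n. ?c j)"
    unfolding n_def by (rule card_compositions) auto
  also have "\<dots> = (\<Sum>j<k. ?c j)"
  proof (rule sum.mono_neutral_right)
    show "\<forall>j\<in>{..n} - {..<k}. ?c j = 0"
    proof
      fix j assume "j \<in> {..n} - {..<k}"
      then have "k \<le> j" by auto
      then have "k * t \<le> j * t" "0 < j" using assms by auto
      then have "k * t < j * (t + 1)" by (simp only: distrib_left mult_1_right)
      then show "?c j = 0" by simp
    qed
  qed (use assms in \<open>auto simp: n_def\<close>)
  also have "\<dots> = (\<Sum>j<k. (-1) ^ j * real (n choose j) / fact (n - 1) *
      pochhammer (1 - real j + (real k - real j) * real t) (n - 1))"
  proof (rule sum.cong[OF refl])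
    fix j assume "j \<in> {..<k}"
    then have j: "j < k" by simp
    have "(if k * t < j * (t + 1) then 0 else real ((k * t - j * (t + 1) + (n - 1)) choose (n - 1)))
        = pochhammer (1 - real j + (real k - real j) * real t) (n - 1) / fact (n - 1)"
    proof (cases "k * t < j * (t + 1)")
      case False
      then have eq: "real (k * t - j * (t + 1)) + 1 = 1 - real j + (real k - real j) * real t"
        by (simp add: of_nat_diff algebra_simps)
      show ?thesis unfolding if_not_P[OF False] binomial_pochhammer eq ..
    next
      case True
      \<comment> \<open>Where the count truncates to 0, the polynomial must vanish too: its rising
        factorial starts at \<open>-(r - 1)\<close>, and \<open>r \<le> j < n\<close> makes it long
        enough to contain the factor 0.\<close>
      define r where "r = j * (t + 1) - k * t"
      have "(k - j) * t + r = j"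
        using True j by (simp add: r_def algebra_simps diff_mult_distrib)
      then have "r \<le> j" by simp
      have r: "1 - real j + (real k - real j) * real t = - real (r - 1)" "0 < r"
        using True by (simp_all add: r_def of_nat_diff algebra_simps)
      have zero: "pochhammer (- real (r - 1)) (n - 1) = 0"
        using r(2) \<open>r \<le> j\<close> j assms
        by (intro pochhammer_of_nat_eq_0_lemma) (auto simp: n_def)
      show ?thesis unfolding if_P[OF True] r(1) zero by simp
    qed
    then show "?c j = (-1) ^ j * real (n choose j) / fact (n - 1) *
      pochhammer (1 - real j + (real k - real j) * real t) (n - 1)" by simp
  qed
  also have "\<dots> = poly (hypersimplex_poly k n) (real t)"
    by (simp add: hypersimplex_poly_def poly_sum poly_poch_poly algebra_simps)
  finally show ?thesis by (simp add: n_def)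
qed

lemma (in sparse_code) is_ehrhart_polynomial_bases:
  "is_ehrhart_polynomial bases (hypersimplex_poly k CARD('n) -
     smult (real (card S)) (cut_poly (k - 1) (CARD('n) - k - 1)))"
  unfolding is_ehrhart_polynomial_def
proof
  fix t
  have "real (card (compositions t (UNIV :: 'n set) (k * t)))
      = real (card (dilate_points t)) + real (card S) * poly (cut_poly (k - 1) (CARD('n) - k - 1)) (real t)"
    by (simp add: card_compositions_split card_cut_points poly_cut_poly)
  then show "poly (hypersimplex_poly k CARD('n) -
     smult (real (card S)) (cut_poly (k - 1) (CARD('n) - k - 1))) (real t)
     = real (card ((\<lambda>x. real t *\<^sub>R x) ` base_polytope bases \<inter> lattice_points))"
    by (simp add: card_dilate poly_hypersimplex_poly[OF k_pos k_less])
qed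

subsection \<open>The matroid on 20 elements\<close>

text \<open>Multiplication by \<open>[:d, b:]\<close> never lowers degrees, so coefficients up to
  the cubic one can be computed exactly from truncated tuples.\<close>

fun mult_linear :: "int \<Rightarrow> int \<Rightarrow> int \<times> int \<times> int \<times> int \<Rightarrow> int \<times> int \<times> int \<times> int" where
  "mult_linear d b (c0, c1, c2, c3) = (d * c0, d * c1 + b * c0, d * c2 + b * c1, d * c3 + b * c2)"

primrec low_coeffs :: "int \<Rightarrow> int \<Rightarrow> nat \<Rightarrow> int \<times> int \<times> int \<times> int" where
  "low_coeffs a b 0 = (1, 0, 0, 0)"
| "low_coeffs a b (Suc m) = mult_linear (a + int m) b (low_coeffs a b m)"

lemma low_coeffs_numeral [simp]:
  "low_coeffs a b (numeral v) = mult_linear (a + int (pred_numeral v)) b (low_coeffs a b (pred_numeral v))"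
  by (simp add: numeral_eq_Suc)

lemma coeff_poch_poly:
  "low_coeffs a b m = (c0, c1, c2, c3) \<Longrightarrow>
    coeff (poch_poly (of_int a) (of_int b) m) 0 = of_int c0 \<and>
    coeff (poch_poly (of_int a) (of_int b) m) 1 = of_int c1 \<and>
    coeff (poch_poly (of_int a) (of_int b) m) 2 = of_int c2 \<and>
    coeff (poch_poly (of_int a) (of_int b) m) 3 = of_int c3"
proof (induction m arbitrary: c0 c1 c2 c3)
  case 0
  then show ?case by (auto simp: poch_poly_def)
next
  case (Suc m)
  obtain d0 d1 d2 d3 where d: "low_coeffs a b m = (d0, d1, d2, d3)" by (metis prod_cases4)
  have rec: "poch_poly (of_int a) (of_int b) (Suc m)
      = poch_poly (of_int a) (of_int b) m * [:of_int a + real m, of_int b:]"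
    by (simp add: poch_poly_def)
  show ?case using Suc.prems Suc.IH[OF d] d
    by (auto simp: rec numeral_2_eq_2 numeral_3_eq_3)
qed

lemma coeffs_hypersimplex_poly_9_20:
  "coeff (hypersimplex_poly 9 20) 2 = 1506987616129 / 15437822400"
  "coeff (hypersimplex_poly 9 20) 3 = 3536577750991 / 7351344000"
proof -
  have *: "coeff (poch_poly (1 - real j) (9 - real j) 19) 2 = of_int c2 \<and>
      coeff (poch_poly (1 - real j) (9 - real j) 19) 3 = of_int c3"
    if "low_coeffs (1 - int j) (9 - int j) 19 = (c0, c1, c2, c3)" for j c0 c1 c2 c3
    using coeff_poch_poly[OF that] by simp
  note coeffs =
      *[of 0, simplified]
      *[of 1, simplified]
      *[of 2, simplified]
      *[of 3, simplified]
      *[of 4, simplified]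
      *[of 5, simplified]
      *[of 6, simplified]
      *[of 7, simplified]
      *[of 8, simplified]
  show "coeff (hypersimplex_poly 9 20) 2 = 1506987616129 / 15437822400"
       "coeff (hypersimplex_poly 9 20) 3 = 3536577750991 / 7351344000"
    by (simp_all add: hypersimplex_poly_def coeff_sum lessThan_nat_numeral coeffs
        binomial_fact fact_numeral)
qed

lemma coeffs_cut_poly_8_10:
  "coeff (cut_poly 8 10) 2 = 577 / 45360"
  "coeff (cut_poly 8 10) 3 = 1073 / 15680"
proof -
  have *: "coeff (poch_poly 0 1 m) 0 = of_int c0 \<and> coeff (poch_poly 0 1 m) 1 = of_int c1 \<and>
      coeff (poch_poly 0 1 m) 2 = of_int c2 \<and> coeff (poch_poly 0 1 m) 3 = of_int c3"
    if "low_coeffs 0 1 m = (c0, c1, c2, c3)" for m c0 c1 c2 c3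
    using coeff_poch_poly[of 0 1 m] that by simp
  note coeffs =
      *[of 0, simplified]
      *[of 1, simplified]
      *[of 2, simplified]
      *[of 3, simplified]
      *[of 4, simplified]
      *[of 5, simplified]
      *[of 6, simplified]
      *[of 7, simplified]
      *[of 8, simplified]
      *[of 11, simplified]
  define Q where "Q = (\<Sum>j\<le>8. smult (real ((10 + j) choose j) / fact j) (poch_poly 0 1 j))"
  \<comment> \<open>Degrees up to 2 suffice, since the other factor \<open>poch_poly 0 1 11\<close>
    has no constant term.\<close>
  have Q: "coeff Q 0 = 1" "coeff Q 1 = 370051 / 35" "coeff Q 2 = 130649959 / 5040"
    unfolding Q_def
    by (simp_all add: coeff_sum atMost_nat_numeral coeffs binomial_fact fact_numeral)
  have cut: "cut_poly 8 10 = smult (1 / (fact 11 * real (19 choose 8))) (poch_poly 0 1 11 * Q)"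
    by (simp add: cut_poly_def Q_def)
  show "coeff (cut_poly 8 10) 2 = 577 / 45360"
       "coeff (cut_poly 8 10) 3 = 1073 / 15680"
    unfolding cut
    by (simp_all add: coeff_mult atMost_nat_numeral coeffs Q Q(2)[unfolded One_nat_def] binomial_fact
        fact_numeral)
qed

theorem theorem5p3:
  "\<exists>\<B> :: 20 set set.
     matroid UNIV \<B> \<and> sparse_paving UNIV \<B> \<and>
     card (UNIV :: 20 set) = 20 \<and> rank_of \<B> UNIV = 9 \<and>
     card (circuit_hyperplanes UNIV \<B>) = 8398 \<and>
     (\<exists>p. is_ehrhart_polynomial \<B> p \<and> coeff p 2 < 0 \<and> coeff p 3 < 0)"
proof -
  \<comment> \<open>This is an equality: both sides are 167960. The type \<open>20\<close> carries
    addition modulo 20, the group used by \<open>exists_sparse_code\<close>.\<close>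
  have "8398 * CARD(20) \<le> CARD(20) choose 9"
    by (simp add: binomial_fact' fact_numeral)
  then obtain S :: "20 set set" where S: "sparse_code 9 S" "card S = 8398"
    using exists_sparse_code[where ?'n = 20, of 9 8398] by auto
  interpret sparse_code 9 S by (rule S(1))
  have "is_ehrhart_polynomial bases (hypersimplex_poly 9 20 - smult 8398 (cut_poly 8 10))"
    using is_ehrhart_polynomial_bases by (simp add: S(2))
  \<comment> \<open>Numerically, about 97.6 - 106.8 for the quadratic and 481.1 - 574.7 for the
    cubic coefficient.\<close>
  moreover have "coeff (hypersimplex_poly 9 20 - smult 8398 (cut_poly 8 10)) 2 < 0"
    "coeff (hypersimplex_poly 9 20 - smult 8398 (cut_poly 8 10)) 3 < 0"
    using coeffs_hypersimplex_poly_9_20 coeffs_cut_poly_8_10 by simp_all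
  ultimately show ?thesis
    using matroid_bases sparse_paving_bases rank_UNIV circuit_hyperplanes_eq S(2)
    by (intro exI[of _ bases] conjI exI[of _ "hypersimplex_poly 9 20 - smult 8398 (cut_poly 8 10)"]) auto
qed

end
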